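(* Let $\pi\in S_n$ have LTR-max decomposition $\pi=M_1P_1M_2$ with $M_2\neq\emptyset$, and let $m_1=|M_1|$, $p_1=|P_1|$, $m_2=|M_2|$. Then \[|q^{-1}(\pi)|=\sum_{i=1}^{m_2}\sum_{j=0}^{i-1}\binom{i-1}{j}\left(\sum_{l=0}^{m_1-2}\left(\!\binom{m_1-l}{j+1}\!\right)b_{m_1-1,l+1}\right)\left(\sum_{k=2}^{m_2-i+1}g_{m_2-i,k}\left(\!\binom{k}{p_1+i-j-1}\!\right)\right),\] where every summation whose index set is empty is taken to equal $1$.
   Context: $S_n$ is the set of permutations of $\{1,\dots,n\}$ in one-line notation. An entry $\pi_i$ is a left-to-right (LTR) maximum if $\pi_i>\pi_j$ for all $j<i$. The map $q:S_n\to S_n$ (the algorithm Queuesort, sorting with a queue allowing bypass): let $m_1,\dots,m_r$ be the LTR maxima of $\pi$ from left to right; for $i=r,\dots,1$ in this order, repeatedly swap $m_i$ with the entry immediately to its right as long as such an entry exists and is smaller than $m_i$; the result is $q(\pi)$. $q^{-1}(\pi)=\{\sigma: q(\sigma)=\pi\}$. The LTR-max decomposition $\pi=M_1P_1M_2$ means: $M_1$ is the maximal initial factor of consecutive LTR maxima, $P_1$ is a nonempty factor of non-LTR-maxima, and $M_2$ is the final factor consisting of LTR maxima, and these are all the LTR maxima. $S_n(321)$ is the set of $\pi\in S_n$ avoiding $321$ (no $a<b<c$ with $\pi_a>\pi_b>\pi_c$). For $n\ge1$, $1\le i\le n$: $b_{n,i}=|\{\pi\in S_n(321):\pi_i=n\}|$.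 For $n\ge1$, $2\le i\le n$: $g_{n,i}$ is the number of $\pi\in S_n(321)$ such that $\pi_i$ is not an LTR maximum but $\pi_j$ is an LTR maximum for all $j<i$; and $g_{n,n+1}=1$. $\left(\!\binom{u}{v}\!\right)=\binom{u+v-1}{v}$ is the number of multisets of size $v$ from a set of size $u$. *)

theory Defs
  imports Main "HOL-Combinatorics.Multiset_Permutations"
begin

text \<open>A permutation in \<open>S\<^sub>n\<close> is the list of its one-line notation. List positions are
  0-based, so the entry \<open>\<pi>\<^sub>i\<close> is \<open>p ! (i - 1)\<close>.\<close>

abbreviation Sym :: "nat \<Rightarrow> nat list set" where
  "Sym n \<equiv> permutations_of_set {1..n}"

definition ltr_max_at :: "nat list \<Rightarrow> nat \<Rightarrow> bool" where
  "ltr_max_at p k \<longleftrightarrow> k < length p \<and> (\<forall>j<k. p ! j < p ! k)"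

definition ltr_maxima :: "nat list \<Rightarrow> nat list" where
  "ltr_maxima p = map (\<lambda>k. p ! k) (filter (ltr_max_at p) [0..<length p])"

text \<open>\<open>push_head\<close> moves the head of a list to the right by adjacent swaps as long as its right
  neighbour exists and is smaller; \<open>push_entry m\<close> does this to the entry \<open>m\<close>.\<close>

fun push_head :: "nat list \<Rightarrow> nat list" where
  "push_head (x # y # ys) = (if y < x then y # push_head (x # ys) else x # y # ys)"
| "push_head xs = xs"

fun push_entry :: "nat \<Rightarrow> nat list \<Rightarrow> nat list" where
  "push_entry m [] = []"
| "push_entry m (x # xs) = (if x = m then push_head (x # xs) else x # push_entry m xs)"

text \<open>\<open>foldr\<close> treats the rightmost left-to-right maximum first. The maxima are those of
  the input and are not recomputed along the way.\<close>

definition queuesort :: "nat list \<Rightarrow> nat list" where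
  "queuesort p = foldr push_entry (ltr_maxima p) p"

definition queuesort_preimage :: "nat \<Rightarrow> nat list \<Rightarrow> nat list set" where
  "queuesort_preimage n p = {s \<in> Sym n. queuesort s = p}"

text \<open>\<open>p = M1 P1 M2\<close>, where \<open>M1\<close> and \<open>M2\<close> (possibly empty) together contain all the
  left-to-right maxima. Maximality of \<open>M1\<close> as an initial factor of left-to-right maxima
  follows from \<open>P1\<close> being nonempty.\<close>

definition ltr_max_decomp :: "nat list \<Rightarrow> nat list \<Rightarrow> nat list \<Rightarrow> nat list \<Rightarrow> bool" where
  "ltr_max_decomp p M1 P1 M2 \<longleftrightarrow>
     p = M1 @ P1 @ M2 \<and> P1 \<noteq> [] \<and>
     (\<forall>k<length p. ltr_max_at p k \<longleftrightarrow> k < length M1 \<or> length M1 + length P1 \<le> k)"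

definition avoids_321 :: "nat list \<Rightarrow> bool" where
  "avoids_321 p \<longleftrightarrow>
     \<not> (\<exists>a b c. a < b \<and> b < c \<and> c < length p \<and> p ! a > p ! b \<and> p ! b > p ! c)"

definition Sym_321 :: "nat \<Rightarrow> nat list set" where
  "Sym_321 n = {p \<in> Sym n. avoids_321 p}"

text \<open>\<open>b_num n i\<close> is meant for \<open>1 \<le> i \<le> n\<close>, \<open>g_num n i\<close> for \<open>1 \<le> n\<close> and
  \<open>2 \<le> i \<le> n + 1\<close>.\<close>

definition b_num :: "nat \<Rightarrow> nat \<Rightarrow> nat" where
  "b_num n i = card {p \<in> Sym_321 n. p ! (i - 1) = n}"

definition g_num :: "nat \<Rightarrow> nat \<Rightarrow> nat" where
  "g_num n i =
     (if i = n + 1 then 1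
      else card {p \<in> Sym_321 n. \<not> ltr_max_at p (i - 1) \<and> (\<forall>j<i - 1. ltr_max_at p j)})"

definition multichoose :: "nat \<Rightarrow> nat \<Rightarrow> nat" where
  "multichoose u v = (u + v - 1) choose v"

text \<open>Summation under the convention that an empty sum equals 1.\<close>

definition sum1 :: "('a \<Rightarrow> nat) \<Rightarrow> 'a set \<Rightarrow> nat" where
  "sum1 f A = (if A = {} then 1 else sum f A)"

end

theory Submission
  imports Defs
begin

text \<open>
  Reading the entries of a preimage \<open>s\<close> of \<open>p\<close> from the left, each entry of \<open>s\<close> is either the
  leftmost remaining entry of \<open>p\<close> (if it is below the current maximum), or a new left-to-right
  maximum that is pulled out of its place in \<open>p\<close>; the latter is possible exactly for the
  left-to-right maxima of \<open>p\<close> that are not followed by a descent. Only the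
  number of remaining entries lying to the left of the last maximum pulled out matters for the
  continuation, so the number of preimages is a number of
  lattice paths whose steps are prescribed by the pattern of these admissible maxima. For
  \<open>p = M1 P1 M2\<close> the pattern is \<open>m1 - 1\<close> times yes, \<open>p1 + 1\<close> times no, \<open>m2\<close> times yes. Permutations
  avoiding 321 with a prescribed increasing suffix satisfy the same recursion (insert the
  largest entry), which identifies the two ballot-like factors of the formula with path counts.
\<close>

section \<open>Lattice paths\<close>

text \<open>The state \<open>d\<close> is the number of entries left over before the current position. The counts below
  satisfy recursions of the same shape: \<open>suffix_num\<close> follows the end point of a path with all flags
  true, and \<open>free_paths\<close> counts such paths from a given start.\<close>

fun flag_paths :: "nat \<Rightarrow> bool list \<Rightarrow> nat" where
  "flag_paths d [] = (if d = 0 then 1 else 0)"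
| "flag_paths d (b # fs) = (if b then \<Sum>d'\<le>Suc d. flag_paths d' fs else flag_paths (Suc d) fs)"

fun suffix_num :: "nat \<Rightarrow> nat \<Rightarrow> nat" where
  "suffix_num 0 s = (if s = 0 then 1 else 0)"
| "suffix_num (Suc n) s = (\<Sum>k = s - 1..n. suffix_num n k)"

fun free_paths :: "nat \<Rightarrow> nat \<Rightarrow> nat" where
  "free_paths 0 v = 1"
| "free_paths (Suc m) v = (\<Sum>h\<le>v. free_paths m (Suc h))"

text \<open>Exchanging the two summations moves the last step of a path from the end-point count to
  the weight: an end point \<open>k\<close> can be continued to every
  \<open>s \<le> Suc k\<close>.\<close>

lemma sum_suffix_num_Suc: "(\<Sum>s\<le>Suc m. suffix_num (Suc m) s * f s)
    = (\<Sum>k\<le>m. suffix_num m k * (\<Sum>s\<le>Suc k. f s))"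
proof -
  have "(\<Sum>s\<le>Suc m. suffix_num (Suc m) s * f s) = (\<Sum>s\<le>Suc m. \<Sum>k\<in>{k\<in>{..m}. s \<le> Suc k}. suffix_num m k * f s)"
    unfolding suffix_num.simps sum_distrib_right by (intro sum.cong refl) auto
  also have "\<dots> = (\<Sum>k\<le>m. \<Sum>s\<in>{s\<in>{..Suc m}. s \<le> Suc k}. suffix_num m k * f s)"
    by (rule sum.swap_restrict) auto
  also have "\<dots> = (\<Sum>k\<le>m. \<Sum>s\<le>Suc k. suffix_num m k * f s)"
    by (intro sum.cong) auto
  finally show ?thesis by (simp only: sum_distrib_left)
qed

lemma flag_paths_True_prefix:
  "flag_paths 0 (replicate m True @ fs) = (\<Sum>s\<le>m. suffix_num m s * flag_paths s fs)"
proof (induction m arbitrary: fs)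
  case (Suc m)
  \<comment> \<open>The block is peeled at its right end, so that the induction hypothesis applies
    with \<open>True # fs\<close> as the remaining flags.\<close>
  have "replicate (Suc m) True @ fs = replicate m True @ True # fs"
    by (simp add: replicate_app_Cons_same)
  then show ?case using Suc by (simp only: sum_suffix_num_Suc) simp
qed simp

text \<open>With all flags true the state 0 is reachable from every state in one step, so the last
  step is forced and only \<open>k\<close> of the \<open>Suc k\<close> steps carry a choice.\<close>

lemma flag_paths_replicate_True: "flag_paths d (replicate (Suc k) True) = free_paths k (Suc d)"
proof (induction k arbitrary: d)
  case 0 show ?case by (induction d) auto
next
  case (Suc k)
  have "flag_paths d (replicate (Suc (Suc k)) True) = (\<Sum>d'\<le>Suc d. flag_paths d' (replicate (Suc k) True))"
    by simp
  also have "\<dots> = (\<Sum>d'\<le>Suc d. free_paths k (Suc d'))" using Suc by simp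
  finally show ?case by simp
qed

lemma flag_paths_False_prefix: "flag_paths d (replicate p False @ fs) = flag_paths (d + p) fs"
  by (induction p arbitrary: d) auto

text \<open>The hockey-stick identity, applied in both directions, turns the weight summed over
  \<open>s \<le> Suc k\<close> into a sum over \<open>h \<le> Suc t\<close> of weights of the same
  kind at \<open>k\<close>. This is exactly the recursion of \<open>free_paths\<close>.\<close>

lemma sum_suffix_num_choose: "(\<Sum>s\<le>m. suffix_num m s * ((t + s) choose s)) = free_paths m (Suc t)"
proof (induction m arbitrary: t)
  case (Suc m)
  have hs: "(\<Sum>s\<le>Suc k. (t + s) choose s) = (\<Sum>h\<le>Suc t. (h + k) choose k)" for k
  proof -
    have "(\<Sum>s\<le>Suc k. (t + s) choose s) = Suc (t + Suc k) choose Suc k"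
      using sum_choose_lower[of t "Suc k"] by simp
    also have "\<dots> = Suc (k + Suc t) choose Suc t"
      by (subst binomial_symmetric) (auto simp: add.commute)
    also have "\<dots> = (\<Sum>h\<le>Suc t. (k + h) choose h)"
      by (rule sum_choose_lower[symmetric])
    also have "\<dots> = (\<Sum>h\<le>Suc t. (h + k) choose k)"
      by (intro sum.cong refl) (subst binomial_symmetric, auto simp: add.commute)
    finally show ?thesis .
  qed
  have "(\<Sum>s\<le>Suc m. suffix_num (Suc m) s * ((t + s) choose s))
      = (\<Sum>k\<le>m. \<Sum>h\<le>Suc t. suffix_num m k * ((h + k) choose k))"
    by (simp only: sum_suffix_num_Suc hs sum_distrib_left)
  also have "\<dots> = (\<Sum>h\<le>Suc t. \<Sum>k\<le>m. suffix_num m k * ((h + k) choose k))"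
    by (rule sum.swap)
  finally show ?case using Suc by simp
qed simp

text \<open>The binomial is \<open>multichoose (s + 2) v\<close>, so this is the shape in which both
  inner sums of the formula appear. The induction again rests on two hockey-stick sums.\<close>

lemma free_paths_Suc_eq: "free_paths (Suc m) v = (\<Sum>s\<le>m. suffix_num m s * ((s + 1 + v) choose v))"
proof (induction m arbitrary: v)
  case 0 show ?case by simp
next
  case (Suc m)
  have hs: "(\<Sum>h\<le>v. (k + 1 + Suc h) choose Suc h) = (\<Sum>s\<le>Suc k. (s + 1 + v) choose v)" for k
  proof -
    \<comment> \<open>Adding the missing term of index 0, which is 1, completes both sums to full
      hockey-stick sums with a common value.\<close>
    have "1 + (\<Sum>h\<le>v. (k + 1 + Suc h) choose Suc h) = (\<Sum>h\<le>Suc v. (k + 1 + h) choose h)"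
      by (subst sum.atMost_Suc_shift) simp
    also have "\<dots> = Suc (k + 1 + Suc v) choose Suc v"
      by (rule sum_choose_lower)
    also have "\<dots> = Suc (v + Suc (Suc k)) choose Suc (Suc k)"
      by (subst binomial_symmetric) (auto simp: add.commute)
    also have "\<dots> = (\<Sum>s\<le>Suc (Suc k). (v + s) choose s)"
      by (rule sum_choose_lower[symmetric])
    also have "\<dots> = 1 + (\<Sum>s\<le>Suc k. (v + Suc s) choose Suc s)"
      by (subst sum.atMost_Suc_shift) simp
    also have "(\<Sum>s\<le>Suc k. (v + Suc s) choose Suc s) = (\<Sum>s\<le>Suc k. (s + 1 + v) choose v)"
      by (intro sum.cong refl) (subst binomial_symmetric, auto simp: add.commute)
    finally show ?thesis by simp
  qed
  have "free_paths (Suc (Suc m)) v = (\<Sum>h\<le>v. \<Sum>s\<le>m. suffix_num m s * ((s + 1 + Suc h) choose Suc h))"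
    using Suc by simp
  also have "\<dots> = (\<Sum>s\<le>m. \<Sum>h\<le>v. suffix_num m s * ((s + 1 + Suc h) choose Suc h))"
    by (rule sum.swap)
  also have "\<dots> = (\<Sum>s\<le>m. suffix_num m s * (\<Sum>h\<le>Suc s. (h + 1 + v) choose v))"
    by (simp only: hs flip: sum_distrib_left)
  finally show ?case by (simp only: sum_suffix_num_Suc)
qed

text \<open>The rule \<open>step\<close> either lowers the second argument by one, or lowers
  \<open>K\<close> by one and raises the second argument by one. Iterate it until
  \<open>t + 1\<close> lowerings of the first kind have taken place: with \<open>i\<close> raises in
  between and a lowering at the end there are \<open>(i + t) choose t\<close> orders.\<close>

lemma free_paths_expand: "free_paths K (q + Suc t) = (\<Sum>i\<le>K. ((i + t) choose t) * free_paths (K - i) (q + i))"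
proof (induction K arbitrary: t q)
  case (Suc K)
  note IH = this
  have step: "free_paths (Suc K) (Suc v) = free_paths (Suc K) v + free_paths K (Suc (Suc v))" for v by simp
  show ?case
  proof (induction t)
    case 0
    show ?case using IH[of "Suc q" 0] step[of q] by (subst sum.atMost_Suc_shift) simp
  next
    case (Suc t)
    have "free_paths (Suc K) (q + Suc (Suc t)) = free_paths (Suc K) (q + Suc t) + free_paths K (Suc q + Suc (Suc t))"
      using step[of "q + Suc t"] by simp
    also have "\<dots> = free_paths (Suc K) q + (\<Sum>i\<le>K. ((Suc i + t) choose t) * free_paths (K - i) (q + Suc i))
        + (\<Sum>i\<le>K. ((i + Suc t) choose Suc t) * free_paths (K - i) (q + Suc i))"
      unfolding Suc IH[of "Suc q"] by (subst sum.atMost_Suc_shift) simp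
    also have "\<dots> = free_paths (Suc K) q + (\<Sum>i\<le>K. ((Suc i + Suc t) choose Suc t) * free_paths (K - i) (q + Suc i))"
      by (simp add: sum.distrib[symmetric] algebra_simps)
    also have "\<dots> = (\<Sum>i\<le>Suc K. ((i + Suc t) choose Suc t) * free_paths (Suc K - i) (q + i))"
      by (simp only: sum.atMost_Suc_shift diff_Suc_Suc) simp
    finally show ?case .
  qed
qed simp

lemma flag_paths_decomp:
  "flag_paths 0 (replicate m True @ replicate (Suc p) False @ replicate (Suc K) True)
   = (\<Sum>N\<le>K. \<Sum>j\<le>N. (N choose j) * free_paths m (Suc j) * free_paths (K - N) (p + N - j))" (is "?L = ?R")
proof -
  \<comment> \<open>A path at \<open>s\<close> after the first block is at \<open>s + Suc p\<close>
    after the false flags; one more \<open>Suc\<close> comes from the forced last step of the final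
    block.\<close>
  have "?L = (\<Sum>s\<le>m. suffix_num m s * free_paths K (Suc p + Suc s))"
    by (simp only: flag_paths_True_prefix flag_paths_False_prefix flag_paths_replicate_True add.commute add_Suc_right add_Suc)
  also have "\<dots> = (\<Sum>s\<le>m. \<Sum>i\<le>K. suffix_num m s * ((i + s) choose s) * free_paths (K - i) (Suc p + i))"
    by (simp only: free_paths_expand sum_distrib_left mult.assoc)
  also have "\<dots> = (\<Sum>i\<le>K. \<Sum>s\<le>m. suffix_num m s * ((i + s) choose s) * free_paths (K - i) (Suc p + i))"
    by (rule sum.swap)
  also have "\<dots> = (\<Sum>i\<le>K. free_paths m (Suc i) * free_paths (K - i) (p + Suc i))"
    by (simp only: sum_suffix_num_choose flip: sum_distrib_right) simp
  \<comment> \<open>A second expansion, now with \<open>t = i\<close>, produces the binomial that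
    becomes \<open>N choose j\<close> under \<open>N = i + i'\<close> and
    \<open>j = i\<close>.\<close>
  also have "\<dots> = (\<Sum>i\<le>K. \<Sum>i'\<le>K - i. ((i' + i) choose i) * free_paths m (Suc i) * free_paths (K - i - i') (p + i'))"
    by (simp only: free_paths_expand sum_distrib_left) (simp only: mult_ac)
  also have "\<dots> = (\<Sum>(i,i')\<in>{(i,i'). i + i' \<le> K}. ((i' + i) choose i) * free_paths m (Suc i) * free_paths (K - i - i') (p + i'))"
    by (subst sum.Sigma) (auto intro!: sum.cong)
  also have "\<dots> = ?R"
    by (subst sum.triangle_reindex_eq) (auto intro!: sum.cong)
  finally show ?thesis .
qed

section \<open>Preimages under Queuesort\<close>

fun qsort_above :: "nat \<Rightarrow> nat list \<Rightarrow> nat list" where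
  "qsort_above a [] = []"
| "qsort_above a (x # xs) = (if a < x then push_head (x # qsort_above x xs) else x # qsort_above a xs)"

lemma push_head_eq: "push_head (x # ys) = takeWhile (\<lambda>y. y < x) ys @ x # dropWhile (\<lambda>y. y < x) ys"
  by (induction ys) auto

fun ltr_above :: "nat \<Rightarrow> nat list \<Rightarrow> nat list" where
  "ltr_above a [] = []"
| "ltr_above a (x # xs) = (if a < x then x # ltr_above x xs else ltr_above a xs)"

lemma set_ltr_above: "set (ltr_above a xs) \<subseteq> set xs"
  by (induction xs arbitrary: a) auto

lemma ltr_max_at_Cons: "ltr_max_at (x # xs) k \<longleftrightarrow>
    (case k of 0 \<Rightarrow> True | Suc k' \<Rightarrow> x < xs ! k' \<and> ltr_max_at xs k')"
  unfolding ltr_max_at_def by (auto simp: less_Suc_eq_0_disj split: nat.splits)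

lemma filter_ltr_eq_ltr_above:
  "map ((!) xs) (filter (\<lambda>k. a < xs ! k \<and> ltr_max_at xs k) [0..<length xs]) = ltr_above a xs"
proof (induction xs arbitrary: a)
  case (Cons x xs)
  \<comment> \<open>Both branches continue with the threshold \<open>max a x\<close>, which matches
    the condition on the later positions.\<close>
  have "(if a < x then x # ltr_above x xs else ltr_above a xs) =
     (if a < x then [x] else []) @ ltr_above (max a x) xs"
    by (auto simp: max_def)
  moreover have "map ((!) (x # xs)) (filter (\<lambda>k. a < (x # xs) ! k \<and> ltr_max_at (x # xs) k) [0..<length (x # xs)])
    = (if a < x then [x] else []) @
      map ((!) xs) (filter (\<lambda>k. max a x < xs ! k \<and> ltr_max_at xs k) [0..<length xs])"
    unfolding length_Cons upt_conv_Cons[OF zero_less_Suc] map_Suc_upt[symmetric]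
    by (auto simp: ltr_max_at_Cons filter_map o_def intro!: arg_cong[where f = "map ((!) xs)"] filter_cong)
  ultimately show ?case unfolding Cons by simp
qed simp

lemma ltr_maxima_eq_ltr_above: "0 \<notin> set xs \<Longrightarrow> ltr_maxima xs = ltr_above 0 xs"
proof -
  assume "0 \<notin> set xs"
  then have "\<forall>k<length xs. 0 < xs ! k" by (metis gr0I nth_mem)
  then show ?thesis
    unfolding ltr_maxima_def filter_ltr_eq_ltr_above[symmetric]
    by (auto intro!: arg_cong[where f = "map ((!) xs)"] filter_cong)
qed

lemma foldr_push_entry_Cons:
  "x \<notin> set ms \<Longrightarrow> foldr push_entry ms (x # xs) = x # foldr push_entry ms xs"
  by (induction ms) auto

text \<open>Maxima further right are pushed first and never pass a position to their left. Hence
  \<open>x\<close> still stands at the head, before the already processed tail, when its own turn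
  comes.\<close>

lemma foldr_push_entry_ltr_above: "distinct xs \<Longrightarrow> foldr push_entry (ltr_above a xs) xs = qsort_above a xs"
proof (induction xs arbitrary: a)
  case (Cons x xs)
  have "x \<notin> set (ltr_above c xs)" for c using Cons.prems set_ltr_above by auto
  then show ?case using Cons by (auto simp: foldr_push_entry_Cons)
qed simp

lemma queuesort_eq_qsort_above: "distinct xs \<Longrightarrow> 0 \<notin> set xs \<Longrightarrow> queuesort xs = qsort_above 0 xs"
  by (simp add: queuesort_def ltr_maxima_eq_ltr_above foldr_push_entry_ltr_above)

lemma mset_push_head: "mset (push_head xs) = mset xs"
  by (induction xs rule: push_head.induct) auto

lemma mset_qsort_above: "mset (qsort_above a xs) = mset xs"
  by (induction xs arbitrary: a) (auto simp: mset_push_head)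

section \<open>Counting preimages by their first entry\<close>

definition pre_above :: "nat \<Rightarrow> nat list \<Rightarrow> nat list set" where
  "pre_above a r = {xs. qsort_above a xs = r}"

lemma finite_pre_above: "finite (pre_above a r)"
  by (rule finite_subset[of _ "{xs. mset xs = mset r}"])
     (use finite_permutations_of_multiset[of "mset r"] in \<open>auto simp: pre_above_def mset_qsort_above permutations_of_multiset_def\<close>)

text \<open>A true flag marks an entry that exceeds \<open>a\<close> and all earlier entries and at
  which \<open>push_head\<close> can stop, that is, one that may be the next maximum pulled
  out.\<close>

fun flags :: "nat \<Rightarrow> nat list \<Rightarrow> bool list" where
  "flags a [] = []"
| "flags a (x # v) = (a < x \<and> (v = [] \<or> x < hd v)) # flags (max a x) v"

text \<open>\<open>pre_max b u v\<close> collects the preimages of \<open>u @ v\<close> whose first entry \<open>x\<close> is a maximum pulled out of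
  \<open>v\<close>. The comparison with \<open>hd v2\<close> says that \<open>push_head\<close> stops at the place of \<open>x\<close>.\<close>

definition pre_max :: "nat \<Rightarrow> nat list \<Rightarrow> nat list \<Rightarrow> nat list set" where
  "pre_max b u v = {x # xs | x xs v1 v2. v = v1 @ x # v2 \<and> b < x \<and> (\<forall>y\<in>set v1. y < x) \<and>
      (v2 = [] \<or> x < hd v2) \<and> qsort_above x xs = u @ v1 @ v2}"

lemma pre_max_Nil [simp]: "pre_max b u [] = {}"
  by (simp add: pre_max_def)

lemma pre_max_subset: "ys \<in> pre_max b u v \<Longrightarrow> \<exists>x xs. ys = x # xs \<and> x \<in> set v"
  by (auto simp: pre_max_def)

lemma pre_maxI:
  "v = v1 @ x # v2 \<Longrightarrow> b < x \<Longrightarrow> \<forall>y\<in>set v1. y < x \<Longrightarrow> v2 = [] \<or> x < hd v2 \<Longrightarrow>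
    qsort_above x xs = u @ v1 @ v2 \<Longrightarrow> x # xs \<in> pre_max b u v"
  unfolding pre_max_def by blast

lemma finite_pre_max: "finite (pre_max b u v)"
proof (rule finite_subset[of _ "{xs. mset xs = mset (u @ v)}"])
  show "pre_max b u v \<subseteq> {xs. mset xs = mset (u @ v)}"
  proof
    fix ys assume "ys \<in> pre_max b u v"
    then obtain x xs v1 v2 where *: "ys = x # xs" "v = v1 @ x # v2" "qsort_above x xs = u @ v1 @ v2"
      by (auto simp: pre_max_def)
    have "mset xs = mset (u @ v1 @ v2)" using mset_qsort_above[of x xs] * by simp
    then show "ys \<in> {xs. mset xs = mset (u @ v)}" using * by simp
  qed
  show "finite {xs. mset xs = mset (u @ v)}"
    using finite_permutations_of_multiset[of "mset (u @ v)"] by (simp add: permutations_of_multiset_def)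
qed

text \<open>Either \<open>y\<close> itself is the entry pulled out, or it is passed over. In the
  second case it joins the left part \<open>u\<close>, and the entry pulled out must exceed it as
  well.\<close>

lemma pre_max_Cons:
  "pre_max b u (y # v) = (if b < y \<and> (v = [] \<or> y < hd v) then Cons y ` pre_above y (u @ v) else {})
     \<union> pre_max (max b y) (u @ [y]) v"
proof (intro set_eqI iffI)
  fix ys assume "ys \<in> pre_max b u (y # v)"
  then obtain x xs v1 v2 where *: "ys = x # xs" "y # v = v1 @ x # v2" "b < x" "\<forall>y\<in>set v1. y < x"
    "v2 = [] \<or> x < hd v2" "qsort_above x xs = u @ v1 @ v2" by (auto simp: pre_max_def)
  show "ys \<in> (if b < y \<and> (v = [] \<or> y < hd v) then Cons y ` pre_above y (u @ v) else {})
     \<union> pre_max (max b y) (u @ [y]) v"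
  proof (cases v1)
    case Nil then show ?thesis using * by (auto simp: pre_above_def)
  next
    case (Cons z v1')
    then have "ys \<in> pre_max (max b y) (u @ [y]) v"
      unfolding *(1) using * by (intro pre_maxI[of v v1' x v2]) auto
    then show ?thesis by blast
  qed
next
  fix ys assume "ys \<in> (if b < y \<and> (v = [] \<or> y < hd v) then Cons y ` pre_above y (u @ v) else {})
     \<union> pre_max (max b y) (u @ [y]) v"
  then consider (a) "b < y" "v = [] \<or> y < hd v" "ys \<in> Cons y ` pre_above y (u @ v)"
    | (b) "ys \<in> pre_max (max b y) (u @ [y]) v" by (auto split: if_splits)
  then show "ys \<in> pre_max b u (y # v)"
  proof cases
    case a
    then obtain xs where "ys = y # xs" "qsort_above y xs = u @ [] @ v" by (auto simp: pre_above_def)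
    moreover have "y # v = [] @ y # v" by simp
    ultimately show ?thesis using a(1,2) pre_maxI[of "y # v" "[]" y v b xs u] by simp
  next
    case b
    then obtain x xs v1 v2 where *: "ys = x # xs" "v = v1 @ x # v2" "max b y < x" "\<forall>y\<in>set v1. y < x"
      "v2 = [] \<or> x < hd v2" "qsort_above x xs = (u @ [y]) @ v1 @ v2" unfolding pre_max_def by blast
    have "y # v = (y # v1) @ x # v2" "b < x" "\<forall>z\<in>set (y # v1). z < x"
       "qsort_above x xs = u @ (y # v1) @ v2" using * by auto
    then show ?thesis unfolding *(1) using *(5) by (intro pre_maxI)
  qed
qed

text \<open>Entries may repeat here and \<open>push_head\<close> stops at an equal neighbour, hence
  the weak comparison with \<open>hd v2\<close>. Distinctness makes it strict in
  \<open>pre_above_append\<close>.\<close>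

lemma push_head_eq_iff:
  "push_head (x # ys) = r \<longleftrightarrow>
    (\<exists>v1 v2. r = v1 @ x # v2 \<and> (\<forall>y\<in>set v1. y < x) \<and> (v2 = [] \<or> x \<le> hd v2) \<and> ys = v1 @ v2)"
  (is "?l \<longleftrightarrow> ?r")
proof
  let ?v1 = "takeWhile (\<lambda>y. y < x) ys" and ?v2 = "dropWhile (\<lambda>y. y < x) ys"
  assume ?l
  then have "r = ?v1 @ x # ?v2" by (simp add: push_head_eq)
  moreover have "\<forall>y\<in>set ?v1. y < x" by (auto dest: set_takeWhileD)
  moreover have "?v2 = [] \<or> x \<le> hd ?v2" by (induction ys) auto
  moreover have "ys = ?v1 @ ?v2" by simp
  ultimately show ?r by blast
next
  assume ?r
  then obtain v1 v2 where *: "r = v1 @ x # v2" "\<forall>y\<in>set v1. y < x" "v2 = [] \<or> x \<le> hd v2" "ys = v1 @ v2"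
    by blast
  have "takeWhile (\<lambda>y. y < x) v2 = [] \<and> dropWhile (\<lambda>y. y < x) v2 = v2"
    using *(3) by (cases v2) auto
  then show ?l using * by (simp add: push_head_eq)
qed

lemma Cons_in_pre_above_iff:
  "x # xs \<in> pre_above a r \<longleftrightarrow> x \<le> a \<and> r = x # qsort_above a xs \<or>
    a < x \<and> (\<exists>v1 v2. r = v1 @ x # v2 \<and> (\<forall>y\<in>set v1. y < x) \<and> (v2 = [] \<or> x \<le> hd v2)
        \<and> qsort_above x xs = v1 @ v2)"
  by (cases "a < x") (simp_all add: pre_above_def push_head_eq_iff eq_commute[of r])

text \<open>A first entry of at most \<open>a\<close> is not moved, so it is the first entry of the
  result; as \<open>hd v\<close> exceeds \<open>a\<close>, it must be \<open>hd u\<close>. A first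
  entry above \<open>a\<close> cannot come from \<open>u\<close>, so it is a maximum pulled out of
  \<open>v\<close>.\<close>

lemma pre_above_append:
  assumes "distinct (u @ v)" "\<forall>y\<in>set u. y \<le> a" "v \<noteq> []" "a < hd v"
  shows "pre_above a (u @ v) = (if u = [] then {} else Cons (hd u) ` pre_above a (tl u @ v)) \<union> pre_max a u v"
proof (intro set_eqI iffI)
  fix ys assume ys': "ys \<in> pre_above a (u @ v)"
  moreover have "ys \<noteq> []" using ys' assms(3) by (auto simp: pre_above_def)
  ultimately obtain x xs where ys: "ys = x # xs" by (cases ys) auto
  have *: "x \<le> a \<and> u @ v = x # qsort_above a xs \<or>
      a < x \<and> (\<exists>v1 v2. u @ v = v1 @ x # v2 \<and> (\<forall>y\<in>set v1. y < x) \<and> (v2 = [] \<or> x \<le> hd v2)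
        \<and> qsort_above x xs = v1 @ v2)"
    using ys' unfolding ys Cons_in_pre_above_iff .
  from * show "ys \<in> (if u = [] then {} else Cons (hd u) ` pre_above a (tl u @ v)) \<union> pre_max a u v"
  proof
    assume "x \<le> a \<and> u @ v = x # qsort_above a xs"
    then show ?thesis using ys assms(3,4) by (cases u) (auto simp: pre_above_def)
  next
    assume "a < x \<and> (\<exists>v1 v2. u @ v = v1 @ x # v2 \<and> (\<forall>y\<in>set v1. y < x) \<and> (v2 = [] \<or> x \<le> hd v2)
        \<and> qsort_above x xs = v1 @ v2)"
    then obtain v1 v2 where x: "a < x" and uv: "u @ v = v1 @ x # v2" and v1: "\<forall>y\<in>set v1. y < x"
      and v2: "v2 = [] \<or> x \<le> hd v2" and b: "qsort_above x xs = v1 @ v2" by blast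
    have xu: "x \<notin> set u" using assms(2) x by auto
    from uv obtain w where w: "u = v1 @ w \<and> w @ v = x # v2 \<or> u @ w = v1 \<and> v = w @ x # v2"
      by (auto simp: append_eq_append_conv2)
    have "\<exists>w. v1 = u @ w \<and> v = w @ x # v2"
    proof (cases "u = v1 @ w \<and> w @ v = x # v2")
      case True then show ?thesis using xu by (cases w) auto
    qed (use w in auto)
    then obtain w where w: "v1 = u @ w" "v = w @ x # v2" by blast
    have "v2 = [] \<or> x < hd v2" using v2 assms(1) w(2)
      by (cases v2) auto
    then have "ys \<in> pre_max a u v" unfolding pre_max_def using w ys x v1 b by auto
    then show ?thesis by simp
  qed
next
  fix ys assume "ys \<in> (if u = [] then {} else Cons (hd u) ` pre_above a (tl u @ v)) \<union> pre_max a u v"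
  then consider "u \<noteq> []" "ys \<in> Cons (hd u) ` pre_above a (tl u @ v)" | "ys \<in> pre_max a u v"
    by (auto split: if_splits)
  then show "ys \<in> pre_above a (u @ v)"
  proof cases
    case 1 then show ?thesis using assms(2) by (cases u) (auto simp: pre_above_def)
  next
    case 2
    then obtain x xs v1 v2 where *: "ys = x # xs" "v = v1 @ x # v2" "a < x" "\<forall>y\<in>set v1. y < x"
      "v2 = [] \<or> x < hd v2" "qsort_above x xs = u @ v1 @ v2" unfolding pre_max_def by blast
    have "u @ v = (u @ v1) @ x # v2" "\<forall>y\<in>set (u @ v1). y < x" "v2 = [] \<or> x \<le> hd v2"
      "qsort_above x xs = (u @ v1) @ v2"
      using * assms(2) by auto
    then show ?thesis unfolding *(1) Cons_in_pre_above_iff using *(3) by blast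
  qed
qed

lemma pre_above_le: "\<forall>y\<in>set u. y \<le> a \<Longrightarrow> pre_above a u = {u}"
proof -
  assume u: "\<forall>y\<in>set u. y \<le> a"
  have "qsort_above a xs = xs" if "set xs = set u" for xs
  proof -
    have "\<forall>y\<in>set xs. y \<le> a" using u that by simp
    then show ?thesis by (induction xs) auto
  qed
  moreover have "set xs = set (qsort_above a xs)" for xs using mset_qsort_above by (metis set_mset_mset)
  ultimately show ?thesis unfolding pre_above_def by auto
qed

text \<open>The two counts need each other, so they are proved together: pulling out
  \<open>y\<close> leads to \<open>pre_above\<close>, passing over it to \<open>pre_max\<close>. In
  the first count \<open>d\<close> is the number of entries of \<open>u\<close> still left when the
  next maximum is pulled out. The condition \<open>u @ v \<noteq> []\<close> excludes the case where
  \<open>pre_max\<close> is empty but the path count is 1.\<close>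

lemma card_pre_above_aux:
  "(\<forall>a u. distinct (u @ v) \<longrightarrow> (\<forall>y\<in>set u. y \<le> a) \<longrightarrow> (v = [] \<or> a < hd v) \<longrightarrow>
      card (pre_above a (u @ v)) = (\<Sum>d\<le>length u. flag_paths d (flags a v))) \<and>
   (\<forall>b u. distinct (u @ v) \<longrightarrow> (\<forall>y\<in>set u. y \<le> b) \<longrightarrow> u @ v \<noteq> [] \<longrightarrow>
      card (pre_max b u v) = flag_paths (length u) (flags b v))"
proof (induction v)
  case Nil
  have "(\<Sum>d\<le>n. if d = 0 then 1 else 0) = (1::nat)" for n :: nat by (induction n) auto
  then show ?case by (auto simp: pre_above_le)
next
  case (Cons y v)
  have B: "card (pre_max b u (y # v)) = flag_paths (length u) (flags b (y # v))"
    if "distinct (u @ y # v)" "\<forall>z\<in>set u. z \<le> b" for b u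
  proof -
    \<comment> \<open>The lists on the left start with \<open>y\<close>, those on the right with an
      entry of \<open>v\<close>.\<close>
    have "Cons y ` pre_above y (u @ v) \<inter> pre_max (max b y) (u @ [y]) v = {}"
      using that(1) by (auto dest!: pre_max_subset)
    moreover have "card (pre_max (max b y) (u @ [y]) v) = flag_paths (Suc (length u)) (flags (max b y) v)"
    proof -
      have "z \<le> max b y" if "z \<in> set (u @ [y])" for z
        using that \<open>\<forall>z\<in>set u. z \<le> b\<close> by fastforce
      then show ?thesis using conjunct2[OF Cons, rule_format, of "u @ [y]" "max b y"] that(1) by simp
    qed
    moreover have "card (Cons y ` pre_above y (u @ v)) = (\<Sum>d\<le>length u. flag_paths d (flags y v))"
      if "b < y" "v = [] \<or> y < hd v"
    proof -
      have "\<forall>z\<in>set u. z \<le> y" using \<open>\<forall>z\<in>set u. z \<le> b\<close> that by auto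
      then have "card (pre_above y (u @ v)) = (\<Sum>d\<le>length u. flag_paths d (flags y v))"
        using Cons \<open>distinct (u @ y # v)\<close> that by auto
      then show ?thesis by (simp add: card_image)
    qed
    \<comment> \<open>Pulling out \<open>y\<close> gives the terms \<open>d' \<le> length u\<close>
      of a true flag, passing over it the term \<open>d' = Suc (length u)\<close>; a false flag
      leaves only the latter.\<close>
    ultimately show ?thesis
      by (auto simp: pre_max_Cons card_Un_disjoint finite_pre_above finite_pre_max max_def)
  qed
  have A: "card (pre_above a (u @ y # v)) = (\<Sum>d\<le>length u. flag_paths d (flags a (y # v)))"
    if "distinct (u @ y # v)" "\<forall>z\<in>set u. z \<le> a" "a < y" for a u
    using that
  proof (induction u)
    case Nil
    then show ?case using pre_above_append[of "[]" "y # v" a] B[of "[]" a] by simp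
  next
    case (Cons z u)
    have "Cons z ` pre_above a (u @ y # v) \<inter> pre_max a (z # u) (y # v) = {}"
      using Cons.prems(1) by (auto dest!: pre_max_subset)
    moreover have "pre_above a ((z # u) @ y # v) = Cons z ` pre_above a (u @ y # v) \<union> pre_max a (z # u) (y # v)"
      using pre_above_append[of "z # u" "y # v" a] Cons.prems by simp
    ultimately have "card (pre_above a ((z # u) @ y # v)) = card (pre_above a (u @ y # v)) + card (pre_max a (z # u) (y # v))"
      by (simp add: card_Un_disjoint finite_pre_above finite_pre_max card_image)
    then show ?case using Cons B[of "z # u" a] by simp
  qed
  show ?case using A B by auto
qed

lemma card_queuesort_preimage:
  assumes "p \<in> Sym n"
  shows "card (queuesort_preimage n p) = flag_paths 0 (flags 0 p)"
proof -
  have p: "distinct p" "set p = {1..n}" using assms by (auto simp: permutations_of_set_def)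
  have "queuesort_preimage n p = pre_above 0 p"
  proof (intro set_eqI iffI)
    fix s assume "s \<in> queuesort_preimage n p"
    then show "s \<in> pre_above 0 p"
      by (auto simp: queuesort_preimage_def pre_above_def permutations_of_set_def queuesort_eq_qsort_above)
  next
    fix s assume s: "s \<in> pre_above 0 p"
    then have "mset s = mset p" using mset_qsort_above by (auto simp: pre_above_def)
    then have "set s = {1..n}" "distinct s" using p by (metis set_mset_mset, metis mset_eq_imp_distinct_iff)
    then show "s \<in> queuesort_preimage n p" using s
      by (auto simp: queuesort_preimage_def pre_above_def permutations_of_set_def queuesort_eq_qsort_above)
  qed
  \<comment> \<open>All entries are positive, so the bound 0 stands for an empty prefix and the
    state starts at 0.\<close>
  moreover have "p = [] \<or> 0 < hd p" using p hd_in_set[of p] by fastforce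
  ultimately show ?thesis using conjunct1[OF card_pre_above_aux, rule_format, of "[]" p 0] p(1) by simp
qed

section \<open>Permutations avoiding 321\<close>

lemma sorted_filter_iff:
  "sorted (filter P xs) \<longleftrightarrow>
    (\<forall>b c. b < c \<longrightarrow> c < length xs \<longrightarrow> P (xs ! b) \<longrightarrow> P (xs ! c) \<longrightarrow> xs ! b \<le> xs ! c)"
proof (induction xs)
  case (Cons x xs)
  have "(\<forall>b c. b < c \<longrightarrow> c < length (x # xs) \<longrightarrow> P ((x # xs) ! b) \<longrightarrow> P ((x # xs) ! c)
      \<longrightarrow> (x # xs) ! b \<le> (x # xs) ! c)
    \<longleftrightarrow>
      (P x \<longrightarrow> (\<forall>c < length xs. P (xs ! c) \<longrightarrow> x \<le> xs ! c)) \<and>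
    (\<forall>b c. b < c \<longrightarrow> c < length xs \<longrightarrow> P (xs ! b) \<longrightarrow> P (xs ! c) \<longrightarrow> xs ! b \<le> xs ! c)"
    (is "?l \<longleftrightarrow> ?r")
  proof
    assume l: ?l
    show ?r
    proof (intro conjI allI impI)
      fix c assume "P x" "c < length xs" "P (xs ! c)"
      then show "x \<le> xs ! c" using l[rule_format, of 0 "Suc c"] by simp
    next
      fix b c assume "b < c" "c < length xs" "P (xs ! b)" "P (xs ! c)"
      then show "xs ! b \<le> xs ! c" using l[rule_format, of "Suc b" "Suc c"] by simp
    qed
  next
    assume r: ?r
    show ?l
    proof (intro allI impI)
      fix b c assume "b < c" "c < length (x # xs)" "P ((x # xs) ! b)" "P ((x # xs) ! c)"
      then show "(x # xs) ! b \<le> (x # xs) ! c"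
        using r by (cases b; cases c) auto
    qed
  qed
  moreover have "sorted (filter P (x # xs)) \<longleftrightarrow>
      (P x \<longrightarrow> (\<forall>c < length xs. P (xs ! c) \<longrightarrow> x \<le> xs ! c)) \<and> sorted (filter P xs)"
    by (auto simp: in_set_conv_nth)
  ultimately show ?case using Cons by blast
qed simp

text \<open>As a first entry, \<open>x\<close> can only play the role of 3 in a pattern, so the
  entries below it have to increase.\<close>

lemma avoids_321_Cons:
  "avoids_321 (x # xs) \<longleftrightarrow> sorted (filter (\<lambda>y. y < x) xs) \<and> avoids_321 xs"
proof -
  have "\<not> avoids_321 (x # xs) \<longleftrightarrow>
      \<not> avoids_321 xs \<or> (\<exists>b c. b < c \<and> c < length xs \<and> x > xs ! b \<and> xs ! b > xs ! c)"
    (is "?l \<longleftrightarrow> ?r")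
  proof
    assume ?l
    then obtain a b c where abc: "a < b" "b < c" "c < length (x # xs)"
      "(x # xs) ! a > (x # xs) ! b" "(x # xs) ! b > (x # xs) ! c"
      unfolding avoids_321_def by blast
    then obtain b' c' where "b = Suc b'" "c = Suc c'" by (metis gr0_implies_Suc less_nat_zero_code not_gr0)
    then show ?r using abc by (cases a) (auto simp: avoids_321_def)
  next
    assume ?r
    then show ?l
    proof
      assume "\<not> avoids_321 xs"
      then obtain a b c where "a < b" "b < c" "c < length xs" "xs ! a > xs ! b" "xs ! b > xs ! c"
        unfolding avoids_321_def by blast
      then have "Suc a < Suc b \<and> Suc b < Suc c \<and> Suc c < length (x # xs) \<and>
        (x # xs) ! Suc a > (x # xs) ! Suc b \<and> (x # xs) ! Suc b > (x # xs) ! Suc c" by simp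
      then show ?l unfolding avoids_321_def by blast
    next
      assume "\<exists>b c. b < c \<and> c < length xs \<and> x > xs ! b \<and> xs ! b > xs ! c"
      then obtain b c where "b < c" "c < length xs" "x > xs ! b" "xs ! b > xs ! c" by blast
      then have "0 < Suc b \<and> Suc b < Suc c \<and> Suc c < length (x # xs) \<and> (x # xs) ! 0 > (x # xs) ! Suc b
        \<and> (x # xs) ! Suc b > (x # xs) ! Suc c" by simp
      then show ?l unfolding avoids_321_def by blast
    qed
  qed
  moreover have "sorted (filter (\<lambda>y. y < x) xs) \<longleftrightarrow>
    \<not> (\<exists>b c. b < c \<and> c < length xs \<and> x > xs ! b \<and> xs ! b > xs ! c)"
    unfolding sorted_filter_iff by (meson less_trans not_le)
  ultimately show ?thesis by blast
qed

text \<open>The new maximum can only be the 3 of a pattern, which then lies in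
  \<open>M # r\<close>.\<close>

lemma avoids_321_insert_max:
  assumes "\<forall>y\<in>set (l @ r). y < M"
  shows "avoids_321 (l @ M # r) \<longleftrightarrow> avoids_321 (l @ r) \<and> sorted r"
  using assms
proof (induction l)
  case Nil
  then have "filter (\<lambda>y. y < M) r = r" by simp
  moreover have "sorted r \<Longrightarrow> avoids_321 r"
    by (induction r) (auto simp: avoids_321_Cons avoids_321_def[of "[]"] sorted_wrt_filter)
  ultimately show ?case by (auto simp: avoids_321_Cons)
next
  case (Cons x l)
  then show ?case by (auto simp: avoids_321_Cons)
qed

section \<open>Increasing suffixes and insertion of the largest entry\<close>

definition Sym_321_suffix :: "nat \<Rightarrow> nat \<Rightarrow> nat list set" where
  "Sym_321_suffix n s = {p \<in> Sym_321 n. sorted (drop (n - s) p)}"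

lemma Sym_321D: "p \<in> Sym_321 n \<Longrightarrow> length p = n \<and> distinct p \<and> set p = {1..n} \<and> avoids_321 p"
  by (auto simp: Sym_321_def permutations_of_set_def dest: distinct_card)

lemma Sym_321I: "distinct p \<Longrightarrow> set p = {1..n} \<Longrightarrow> avoids_321 p \<Longrightarrow> p \<in> Sym_321 n"
  by (auto simp: Sym_321_def permutations_of_set_def)

lemma finite_Sym_321: "finite (Sym_321 n)"
  by (simp add: Sym_321_def)

lemma finite_Sym_321_suffix: "finite (Sym_321_suffix n s)"
  by (simp add: Sym_321_suffix_def finite_Sym_321)

definition insert_max :: "nat \<Rightarrow> nat \<Rightarrow> nat list \<Rightarrow> nat list" where
  "insert_max n k p = take (n - k) p @ Suc n # drop (n - k) p"

lemma inj_insert_max: "inj_on (insert_max n k) {p. length p = n}"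
proof (rule inj_onI)
  fix p q assume "p \<in> {p. length p = n}" "q \<in> {p. length p = n}" "insert_max n k p = insert_max n k q"
  then have "take (n - k) p = take (n - k) q \<and> drop (n - k) p = drop (n - k) q"
    unfolding insert_max_def by (subst (asm) append_eq_append_conv) auto
  then show "p = q" by (metis append_take_drop_id)
qed

text \<open>Deleting the largest entry, with \<open>k\<close> entries to its right, is the inverse;
  by \<open>avoids_321_insert_max\<close> the insertion is allowed exactly when these
  \<open>k\<close> entries increase.\<close>

lemma bij_insert_max:
  assumes "k \<le> n"
  shows "bij_betw (insert_max n k) (Sym_321_suffix n k) {p \<in> Sym_321 (Suc n). p ! (n - k) = Suc n}"
  unfolding bij_betw_def
proof
  show "inj_on (insert_max n k) (Sym_321_suffix n k)"
    by (rule inj_on_subset[OF inj_insert_max]) (auto simp: Sym_321_suffix_def dest: Sym_321D)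
  show "insert_max n k ` Sym_321_suffix n k = {p \<in> Sym_321 (Suc n). p ! (n - k) = Suc n}" (is "?A = ?B")
  proof (intro set_eqI iffI)
    fix q assume "q \<in> ?A"
    then obtain p where p: "p \<in> Sym_321 n" "sorted (drop (n - k) p)" "q = insert_max n k p" by (auto simp: Sym_321_suffix_def)
    have *: "length p = n" "distinct p" "set p = {1..n}" "avoids_321 p" using Sym_321D[OF p(1)] by auto
    have "mset (take (n - k) p) + mset (drop (n - k) p) = mset p"
      by (metis append_take_drop_id mset_append)
    then have "mset q = mset (Suc n # p)" unfolding p(3) insert_max_def by simp
    then have "distinct q \<and> set q = {1..Suc n}"
      using * mset_eq_imp_distinct_iff[of q "Suc n # p"] mset_eq_setD[of q "Suc n # p"] by auto
    moreover have "avoids_321 q" unfolding p(3) insert_max_def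
      using avoids_321_insert_max[of "take (n - k) p" "drop (n - k) p" "Suc n"] * p(2) by simp
    moreover have "q ! (n - k) = Suc n" unfolding p(3) insert_max_def using * by (simp add: nth_append)
    ultimately show "q \<in> ?B" by (auto intro: Sym_321I)
  next
    fix q assume "q \<in> ?B"
    then have q: "length q = Suc n" "distinct q" "set q = {1..Suc n}" "avoids_321 q" "q ! (n - k) = Suc n"
      using Sym_321D by auto
    define l r where "l = take (n - k) q" and "r = drop (Suc (n - k)) q"
    have qe: "q = l @ Suc n # r" using id_take_nth_drop[of "n - k" q] q unfolding l_def r_def by simp
    have len: "length l = n - k" using q unfolding l_def by simp
    have "set (l @ r) = set q - {Suc n}" using q(2) unfolding qe by auto
    moreover have "{1..Suc n} - {Suc n} = {1..n}" by auto
    ultimately have s: "set (l @ r) = {1..n}" using q(3) by metis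
    have "\<forall>y\<in>set (l @ r). y < Suc n" unfolding s by auto
    then have a: "avoids_321 (l @ r) \<and> sorted r"
      using avoids_321_insert_max[of l r "Suc n"] q(4) unfolding qe by simp
    have "l @ r \<in> Sym_321_suffix n k" unfolding Sym_321_suffix_def
      using a q(2) s len by (auto intro!: Sym_321I simp: qe)
    moreover have "q = insert_max n k (l @ r)" using qe len by (simp add: insert_max_def)
    ultimately show "q \<in> ?A" by blast
  qed
qed

lemma sorted_drop_mono: "sorted (drop i p) \<Longrightarrow> i \<le> j \<Longrightarrow> sorted (drop j p)"
  by (metis drop_drop le_add_diff_inverse2 sorted_wrt_drop)

text \<open>If the largest entry comes last, it extends an increasing suffix of length
  \<open>s - 1\<close>. Otherwise the last \<open>s\<close> entries either lie to its right and
  increase already, or contain it together with a smaller entry after it.\<close>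

lemma card_Sym_321_suffix_slice:
  assumes "k \<le> n" "s \<le> Suc n"
  shows "card {p \<in> Sym_321_suffix (Suc n) s. p ! (n - k) = Suc n} =
    (if k = 0 then card (Sym_321_suffix n (s - 1)) else if s \<le> k then card (Sym_321_suffix n k) else 0)"
proof -
  let ?X = "{p \<in> Sym_321 (Suc n). p ! (n - k) = Suc n}"
  have bij: "bij_betw (insert_max n k) (Sym_321_suffix n k) ?X" by (rule bij_insert_max) fact
  have inj: "inj_on (insert_max n k) (Sym_321_suffix n k)" using bij by (simp add: bij_betw_def)
  have "{p \<in> Sym_321_suffix (Suc n) s. p ! (n - k) = Suc n} = {p \<in> ?X. sorted (drop (Suc n - s) p)}"
    by (auto simp: Sym_321_suffix_def)
  also have "\<dots> = {p \<in> insert_max n k ` Sym_321_suffix n k. sorted (drop (Suc n - s) p)}"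
    using bij by (simp add: bij_betw_def)
  also have "\<dots> = insert_max n k ` {p \<in> Sym_321_suffix n k. sorted (drop (Suc n - s) (insert_max n k p))}" by auto
  finally have eq: "card {p \<in> Sym_321_suffix (Suc n) s. p ! (n - k) = Suc n} =
      card {p \<in> Sym_321_suffix n k. sorted (drop (Suc n - s) (insert_max n k p))}"
    using card_image[OF inj_on_subset[OF inj]] by (metis (no_types, lifting) mem_Collect_eq subsetI)
  have Sym_321_suffix: "length p = n" "set p = {1..n}" "sorted (drop (n - k) p)" if "p \<in> Sym_321_suffix n k" for p
    using that Sym_321D by (auto simp: Sym_321_suffix_def)
  have "{p \<in> Sym_321_suffix n k. sorted (drop (Suc n - s) (insert_max n k p))} =
    (if k = 0 then Sym_321_suffix n (s - 1) else if s \<le> k then Sym_321_suffix n k else {})"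
  proof -
    consider (a) "k = 0" "s = 0" | (b) "k = 0" "s > 0" | (c) "k > 0" "s \<le> k" | (d) "k > 0" "k < s" by linarith
    then show ?thesis
    proof cases
      case a
      then show ?thesis using Sym_321_suffix by (auto simp: insert_max_def)
    next
      case b
      have "sorted (drop (Suc n - s) (insert_max n 0 p)) \<longleftrightarrow> sorted (drop (n - (s - 1)) p)" if "p \<in> Sym_321_suffix n 0" for p
      proof -
        have p: "length p = n" "set p = {1..n}" using Sym_321_suffix that b by auto
        have "drop (Suc n - s) (insert_max n 0 p) = drop (n - (s - 1)) p @ [Suc n]"
          using p b assms(2) by (simp add: insert_max_def)
        moreover have "\<forall>y\<in>set (drop (n - (s - 1)) p). y \<le> Suc n"
          using p(2) by (auto dest!: in_set_dropD)
        ultimately show ?thesis by (simp add: sorted_append)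
      qed
      moreover have "Sym_321_suffix n (s - 1) \<subseteq> Sym_321_suffix n 0" by (auto simp: Sym_321_suffix_def dest: Sym_321D)
      moreover have "p \<in> Sym_321_suffix n (s - 1) \<longleftrightarrow> sorted (drop (n - (s - 1)) p)" if "p \<in> Sym_321_suffix n 0" for p
        using that by (auto simp: Sym_321_suffix_def)
      ultimately show ?thesis using b by auto
    next
      case c
      have "sorted (drop (Suc n - s) (insert_max n k p))" if "p \<in> Sym_321_suffix n k" for p
      proof (rule sorted_drop_mono)
        show "sorted (drop (Suc (n - k)) (insert_max n k p))" using Sym_321_suffix[OF that] by (simp add: insert_max_def)
        show "Suc (n - k) \<le> Suc n - s" using c assms by linarith
      qed
      then show ?thesis using c by auto
    next
      case d
      have "\<not> sorted (drop (Suc n - s) (insert_max n k p))" if "p \<in> Sym_321_suffix n k" for p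
      proof
        assume "sorted (drop (Suc n - s) (insert_max n k p))"
        then have "sorted (drop (n - k) (insert_max n k p))" by (rule sorted_drop_mono) (use d assms in linarith)
        then have "sorted (Suc n # drop (n - k) p)" using Sym_321_suffix[OF that] by (simp add: insert_max_def)
        then have "\<forall>y\<in>set (drop (n - k) p). Suc n \<le> y" by simp
        moreover have "p ! (n - k) \<in> set (drop (n - k) p)"
          using Sym_321_suffix(1)[OF that] d assms(1) by (metis Cons_nth_drop_Suc diff_less less_le_trans list.set_intros(1))
        moreover have "p ! (n - k) \<le> n" using Sym_321_suffix(1,2)[OF that] d assms(1)
          by (metis atLeastAtMost_iff diff_less less_le_trans nth_mem)
        ultimately show False by fastforce
      qed
      then show ?thesis using d by auto
    qed
  qed
  then show ?thesis unfolding eq by simp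
qed

lemma card_Sym_321_suffix_Suc:
  assumes "s \<le> Suc n"
  shows "card (Sym_321_suffix (Suc n) s) = (\<Sum>k=s - 1..n. card (Sym_321_suffix n k))"
proof -
  have "Sym_321_suffix (Suc n) s = (\<Union>k\<in>{..n}. {p \<in> Sym_321_suffix (Suc n) s. p ! (n - k) = Suc n})"
  proof (intro set_eqI iffI)
    fix p assume p: "p \<in> Sym_321_suffix (Suc n) s"
    then have "length p = Suc n" "Suc n \<in> set p" using Sym_321D by (auto simp: Sym_321_suffix_def)
    then obtain i where "i \<le> n" "p ! i = Suc n" by (metis in_set_conv_nth less_Suc_eq_le)
    then have "n - i \<in> {..n}" "p ! (n - (n - i)) = Suc n" by auto
    then show "p \<in> (\<Union>k\<in>{..n}. {p \<in> Sym_321_suffix (Suc n) s. p ! (n - k) = Suc n})" using p by blast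
  qed blast
  then have "card (Sym_321_suffix (Suc n) s) = card (\<Union>k\<in>{..n}. {p \<in> Sym_321_suffix (Suc n) s. p ! (n - k) = Suc n})" by simp
  also have "\<dots> = (\<Sum>k\<le>n. card {p \<in> Sym_321_suffix (Suc n) s. p ! (n - k) = Suc n})"
  proof (rule card_UN_disjoint)
    show "\<forall>i\<in>{..n}. \<forall>j\<in>{..n}. i \<noteq> j \<longrightarrow>
      {p \<in> Sym_321_suffix (Suc n) s. p ! (n - i) = Suc n} \<inter> {p \<in> Sym_321_suffix (Suc n) s. p ! (n - j) = Suc n} = {}"
    proof (intro ballI impI equals0I)
      fix i j p assume ij: "i \<in> {..n}" "j \<in> {..n}" "i \<noteq> j"
        and "p \<in> {p \<in> Sym_321_suffix (Suc n) s. p ! (n - i) = Suc n} \<inter> {p \<in> Sym_321_suffix (Suc n) s. p ! (n - j) = Suc n}"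
      then have "p ! (n - i) = p ! (n - j)" "distinct p" "length p = Suc n" by (auto simp: Sym_321_suffix_def dest: Sym_321D)
      then show False using ij nth_eq_iff_index_eq[of p "n - i" "n - j"] by auto
    qed
  qed (auto simp: finite_Sym_321_suffix)
  also have "\<dots> = (\<Sum>k\<le>n. if k = 0 then card (Sym_321_suffix n (s - 1)) else if s \<le> k then card (Sym_321_suffix n k) else 0)"
    by (intro sum.cong refl card_Sym_321_suffix_slice) (use assms in auto)
  \<comment> \<open>The slice \<open>k = 0\<close> supplies the summand of index
    \<open>s - 1\<close>, just below the others. For \<open>s = 0\<close> truncated subtraction
    gives index 0, and the others start at 1.\<close>
  also have "\<dots> = card (Sym_321_suffix n (s - 1)) + (\<Sum>k\<in>{..n} - {0}. if s \<le> k then card (Sym_321_suffix n k) else 0)"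
    by (subst sum.remove[of _ 0]) (auto intro!: sum.cong)
  also have "(\<Sum>k\<in>{..n} - {0}. if s \<le> k then card (Sym_321_suffix n k) else 0) = (\<Sum>k=Suc (s - 1)..n. card (Sym_321_suffix n k))"
    by (rule sum.mono_neutral_cong_right) auto
  also have "card (Sym_321_suffix n (s - 1)) + \<dots> = (\<Sum>k=s - 1..n. card (Sym_321_suffix n k))"
    using assms by (subst sum.atLeast_Suc_atMost[of "s - 1"]) auto
  finally show ?thesis .
qed

lemma card_Sym_321_suffix: "s \<le> n \<Longrightarrow> card (Sym_321_suffix n s) = suffix_num n s"
proof (induction n arbitrary: s)
  case 0
  have "Sym_321_suffix 0 0 = {[]}" by (auto simp: Sym_321_suffix_def Sym_321_def avoids_321_def)
  then show ?case using 0 by simp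
next
  case (Suc n)
  then show ?case by (simp add: card_Sym_321_suffix_Suc del: sum.atLeastAtMost_shift_bounds)
qed

text \<open>The largest entry at 0-based position \<open>l\<close> has \<open>n - l\<close> entries
  to its right.\<close>

lemma b_num_eq_suffix_num: "l \<le> n \<Longrightarrow> b_num (Suc n) (Suc l) = suffix_num n (n - l)"
  using bij_betw_same_card[OF bij_insert_max[of "n - l" n]] by (simp add: b_num_def card_Sym_321_suffix)

section \<open>Reverse-complement: from increasing suffixes to increasing prefixes\<close>

definition rev_compl :: "nat \<Rightarrow> nat list \<Rightarrow> nat list" where
  "rev_compl n p = rev (map (\<lambda>x. Suc n - x) p)"

lemma nth_rev_compl: "length p = n \<Longrightarrow> i < n \<Longrightarrow> rev_compl n p ! i = Suc n - p ! (n - Suc i)"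
  by (simp add: rev_compl_def rev_nth)

lemma rev_compl_rev_compl: "set p \<subseteq> {1..n} \<Longrightarrow> rev_compl n (rev_compl n p) = p"
  by (auto simp: rev_compl_def rev_map[symmetric] intro!: map_idI)

text \<open>Positions and values are both reversed, so a 321 pattern of the image comes from one of
  \<open>p\<close>, read backwards.\<close>

lemma rev_compl_Sym_321:
  assumes "p \<in> Sym_321 n"
  shows "rev_compl n p \<in> Sym_321 n"
proof -
  note p = Sym_321D[OF assms]
  have "distinct (rev_compl n p)" using p by (auto simp: rev_compl_def distinct_map inj_on_def)
  moreover have "set (rev_compl n p) = {1..n}"
  proof -
    have "set (rev_compl n p) = (\<lambda>x. Suc n - x) ` {1..n}" using p by (simp add: rev_compl_def)
    also have "\<dots> = {1..n}"
    proof (intro set_eqI iffI)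
      fix x assume "x \<in> {1..n}"
      then have "x = Suc n - (Suc n - x)" "Suc n - x \<in> {1..n}" by auto
      then show "x \<in> (\<lambda>x. Suc n - x) ` {1..n}" by blast
    qed auto
    finally show ?thesis .
  qed
  moreover have "avoids_321 (rev_compl n p)" unfolding avoids_321_def
  proof
    assume "\<exists>a b c. a < b \<and> b < c \<and> c < length (rev_compl n p)
      \<and> rev_compl n p ! a > rev_compl n p ! b \<and> rev_compl n p ! b > rev_compl n p ! c"
    then obtain a b c where *: "a < b" "b < c" "c < n" "rev_compl n p ! a > rev_compl n p ! b" "rev_compl n p ! b > rev_compl n p ! c"
      using p by (auto simp: rev_compl_def)
    then have "Suc n - p ! (n - Suc a) > Suc n - p ! (n - Suc b)"
      "Suc n - p ! (n - Suc b) > Suc n - p ! (n - Suc c)"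
      using p by (simp_all add: nth_rev_compl)
    then have "p ! (n - Suc c) > p ! (n - Suc b)" "p ! (n - Suc b) > p ! (n - Suc a)" by linarith+
    moreover have "n - Suc c < n - Suc b" "n - Suc b < n - Suc a" "n - Suc a < length p" using * p by auto
    ultimately show False using p unfolding avoids_321_def by blast
  qed
  ultimately show ?thesis by (rule Sym_321I)
qed

lemma sorted_take_rev_compl:
  assumes "p \<in> Sym_321 n" "s \<le> n"
  shows "sorted (take s (rev_compl n p)) \<longleftrightarrow> sorted (drop (n - s) p)"
proof -
  note p = Sym_321D[OF assms(1)]
  have "take s (rev_compl n p) = rev (map (\<lambda>x. Suc n - x) (drop (n - s) p))"
    using p by (simp add: rev_compl_def take_rev drop_map)
  also have "sorted \<dots> \<longleftrightarrow> sorted_wrt (\<lambda>x y. Suc n - y \<le> Suc n - x) (drop (n - s) p)"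
    by (simp add: sorted_wrt_rev sorted_wrt_map)
  also have "\<dots> \<longleftrightarrow> sorted (drop (n - s) p)"
  proof (rule iffI; erule sorted_wrt_mono_rel[rotated])
    fix x y assume "x \<in> set (drop (n - s) p)" "y \<in> set (drop (n - s) p)"
    then have "x \<in> {1..n}" "y \<in> {1..n}" using p by (auto dest!: in_set_dropD)
    then show "Suc n - y \<le> Suc n - x \<Longrightarrow> x \<le> y" "x \<le> y \<Longrightarrow> Suc n - y \<le> Suc n - x" by auto
  qed
  finally show ?thesis .
qed

lemma card_sorted_prefix:
  assumes "s \<le> n"
  shows "card {p \<in> Sym_321 n. sorted (take s p)} = suffix_num n s"
proof -
  have "bij_betw (rev_compl n) (Sym_321_suffix n s) {p \<in> Sym_321 n. sorted (take s p)}"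
  proof (rule bij_betwI[where g = "rev_compl n"])
    show "rev_compl n \<in> Sym_321_suffix n s \<rightarrow> {p \<in> Sym_321 n. sorted (take s p)}"
      using rev_compl_Sym_321 sorted_take_rev_compl[OF _ assms] by (auto simp: Sym_321_suffix_def)
    show "rev_compl n \<in> {p \<in> Sym_321 n. sorted (take s p)} \<rightarrow> Sym_321_suffix n s"
    proof
      fix p assume p: "p \<in> {p \<in> Sym_321 n. sorted (take s p)}"
      then have "rev_compl n (rev_compl n p) = p" using Sym_321D rev_compl_rev_compl by auto
      then show "rev_compl n p \<in> Sym_321_suffix n s"
        using p rev_compl_Sym_321[of p n] sorted_take_rev_compl[of "rev_compl n p" n, OF _ assms] by (auto simp: Sym_321_suffix_def)
    qed
  qed (auto simp: Sym_321_suffix_def intro!: rev_compl_rev_compl dest: Sym_321D)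
  then show ?thesis using bij_betw_same_card card_Sym_321_suffix[OF assms] by metis
qed

lemma sorted_take_iff_ltr:
  assumes "distinct p" "s \<le> length p"
  shows "sorted (take s p) \<longleftrightarrow> (\<forall>j<s. ltr_max_at p j)"
proof
  assume "sorted (take s p)"
  moreover have "distinct (take s p)" using assms by simp
  ultimately have "sorted_wrt (<) (take s p)" by (simp add: strict_sorted_iff)
  then show "\<forall>j<s. ltr_max_at p j" using assms(2)
    by (auto simp: ltr_max_at_def sorted_wrt_iff_nth_less)
next
  assume "\<forall>j<s. ltr_max_at p j"
  then show "sorted (take s p)"
    using assms(2) by (auto simp: sorted_iff_nth_mono_less ltr_max_at_def intro!: less_imp_le)
qed

text \<open>The permutations counted have an increasing prefix of length \<open>Suc s\<close> but
  not of length \<open>s + 2\<close>. Both counts are tail sums of \<open>suffix_num n\<close>, and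
  their difference is the single term at \<open>s\<close>. The conventional value at
  \<open>s = n\<close> agrees with \<open>suffix_num n n = 1\<close>.\<close>

lemma g_num_eq_suffix_num:
  assumes "s \<le> n"
  shows "g_num (Suc n) (s + 2) = suffix_num n s"
proof (cases "s = n")
  case True
  have "suffix_num n n = 1" for n by (induction n) auto
  then show ?thesis using True by (simp add: g_num_def)
next
  case False
  then have s: "Suc s \<le> n" using assms by simp
  let ?A = "{p \<in> Sym_321 (Suc n). sorted (take (Suc s) p)}"
  let ?B = "{p \<in> Sym_321 (Suc n). sorted (take (Suc (Suc s)) p)}"
  have *: "sorted (take j p) \<longleftrightarrow> (\<forall>i<j. ltr_max_at p i)" if "p \<in> Sym_321 (Suc n)" "j \<le> Suc n" for p j
    using that Sym_321D sorted_take_iff_ltr by auto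
  have "{p \<in> Sym_321 (Suc n). \<not> ltr_max_at p (Suc s) \<and> (\<forall>j<Suc s. ltr_max_at p j)} = ?A - ?B"
    using s by (auto simp: * less_Suc_eq)
  moreover have "?B \<subseteq> ?A" using s by (auto simp: *)
  moreover have "finite ?A" by (simp add: finite_Sym_321)
  ultimately have "g_num (Suc n) (s + 2) = card ?A - card ?B"
    using s by (simp add: g_num_def card_Diff_subset finite_subset)
  also have "\<dots> = suffix_num (Suc n) (Suc s) - suffix_num (Suc n) (Suc (Suc s))"
    using s by (simp only: card_sorted_prefix)
  also have "\<dots> = suffix_num n s" using s by (simp add: sum.atLeast_Suc_atMost[of s])
  finally show ?thesis .
qed

section \<open>The preimage formula\<close>

lemma length_flags: "length (flags a xs) = length xs"
  by (induction xs arbitrary: a) auto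

lemma nth_flags:
  "k < length xs \<Longrightarrow> flags a xs ! k \<longleftrightarrow>
    a < xs ! k \<and> ltr_max_at xs k \<and> (Suc k = length xs \<or> xs ! k < xs ! Suc k)"
proof (induction xs arbitrary: a k)
  case (Cons x xs)
  show ?case
  proof (cases k)
    case 0
    then show ?thesis by (cases xs) (auto simp: ltr_max_at_Cons)
  next
    case (Suc k')
    then show ?thesis using Cons by (auto simp: ltr_max_at_Cons)
  qed
qed simp

text \<open>The last entry of \<open>M1\<close> is a maximum followed by a descent, so its flag is
  false and joins the block of \<open>P1\<close>; this is why the block has length
  \<open>Suc (length P1)\<close>. The very last entry has no right neighbour and keeps its flag
  true.\<close>

lemma flags_decomp:
  assumes "0 \<notin> set p" "ltr_max_decomp p M1 P1 M2"
  shows "flags 0 p = replicate (length M1 - 1) True @ replicate (Suc (length P1)) False @ replicate (length M2) True"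
    and "M1 \<noteq> []"
proof -
  let ?m = "length M1" and ?p = "length P1"
  have p: "length p = ?m + ?p + length M2" "0 < ?p"
    and ltr: "\<And>k. k < length p \<Longrightarrow> ltr_max_at p k \<longleftrightarrow> k < ?m \<or> ?m + ?p \<le> k"
    using assms(2) by (auto simp: ltr_max_decomp_def)
  show "M1 \<noteq> []"
    using ltr[of 0] p by (auto simp: ltr_max_at_def)
  then have m: "0 < ?m" by simp
  have pos: "0 < p ! k" if "k < length p" for k using assms(1) that by (metis gr0I nth_mem)
  \<comment> \<open>The last entry of \<open>M1\<close> exceeds everything before it, so a larger
    right neighbour would be a left-to-right maximum at the start of \<open>P1\<close>.\<close>
  have desc: "\<not> p ! (?m - 1) < p ! ?m"
  proof
    assume less: "p ! (?m - 1) < p ! ?m"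
    have "ltr_max_at p (?m - 1)" using ltr[of "?m - 1"] p m by linarith
    then have "p ! j < p ! ?m" if "j < ?m" for j
      using that less unfolding ltr_max_at_def
      by (metis One_nat_def Suc_pred less_Suc_eq less_trans m)
    then have "ltr_max_at p ?m" using p by (auto simp: ltr_max_at_def)
    then show False using ltr[of ?m] p by simp
  qed
  show "flags 0 p = replicate (?m - 1) True @ replicate (Suc ?p) False @ replicate (length M2) True"
  proof (rule nth_equalityI)
    show "length (flags 0 p) = length (replicate (?m - 1) True @ replicate (Suc ?p) False @ replicate (length M2) True)"
      using p m by (simp add: length_flags)
    fix k assume "k < length (flags 0 p)"
    then have k: "k < length p" by (simp add: length_flags)
    have next_ltr: "p ! k < p ! Suc k" if "Suc k < length p" "Suc k < ?m \<or> ?m + ?p \<le> Suc k"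
      using ltr[OF that(1)] that(2) by (auto simp: ltr_max_at_def)
    have "flags 0 p ! k \<longleftrightarrow> k < ?m - 1 \<or> ?m + ?p \<le> k"
    proof -
      consider "k < ?m - 1" | "k = ?m - 1" | "?m \<le> k" "k < ?m + ?p" | "?m + ?p \<le> k" by linarith
      then show ?thesis
      proof cases
        case 1
        then have "p ! k < p ! Suc k" using next_ltr p by linarith
        then show ?thesis using nth_flags[OF k, of 0] pos[OF k] ltr[OF k] 1 by auto
      next
        case 2
        then have "\<not> k < ?m - 1" "\<not> ?m + ?p \<le> k" using m p by linarith+
        then show ?thesis using nth_flags[OF k, of 0] desc m p 2 by auto
      next
        case 3 then show ?thesis using nth_flags[OF k, of 0] ltr[OF k] by auto
      next
        case 4
        have "Suc k = length p \<or> p ! k < p ! Suc k" using next_ltr 4 k by linarith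
        then show ?thesis using nth_flags[OF k, of 0] pos[OF k] ltr[OF k] 4 by auto
      qed
    qed
    moreover have "(replicate (?m - 1) True @ replicate (Suc ?p) False @ replicate (length M2) True) ! k
      \<longleftrightarrow> k < ?m - 1 \<or> ?m + ?p \<le> k"
      using k p m by (auto simp: nth_append simp del: replicate_Suc length_greater_0_conv)
    ultimately show "flags 0 p ! k = (replicate (?m - 1) True @ replicate (Suc ?p) False @ replicate (length M2) True) ! k"
      by simp
  qed
qed

section \<open>The two inner sums as path counts\<close>

lemma sum1_g_num: "sum1 (\<lambda>k. g_num K k * multichoose k q) {2..K + 1} = free_paths K q"
proof (cases K)
  case (Suc n)
  have "sum (\<lambda>k. g_num K k * multichoose k q) {2..K + 1}
      = (\<Sum>s\<le>n. g_num (Suc n) (s + 2) * multichoose (s + 2) q)"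
    unfolding Suc
    by (intro sum.reindex_bij_witness[of _ "\<lambda>s. s + 2" "\<lambda>k. k - 2"]) (auto simp del: add_2_eq_Suc')
  also have "\<dots> = (\<Sum>s\<le>n. suffix_num n s * ((s + 1 + q) choose q))"
    by (intro sum.cong refl) (simp only: g_num_eq_suffix_num atMost_iff, simp add: multichoose_def)
  also have "\<dots> = free_paths K q" unfolding Suc by (rule free_paths_Suc_eq[symmetric])
  finally show ?thesis using Suc by (simp add: sum1_def)
\<comment> \<open>For \<open>K = 0\<close> the index set is empty, and the convention gives 1, which
  is \<open>free_paths 0 q\<close>.\<close>
qed (simp add: sum1_def)

text \<open>For \<open>m1 = 1\<close> the index set is empty and both sides are 1; writing it as
  \<open>{0..m1 - 2}\<close> would leave the index 0 in it, by truncated subtraction.\<close>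

lemma sum1_b_num:
  assumes "0 < m1"
  shows "sum1 (\<lambda>l. multichoose (m1 - l) q * b_num (m1 - 1) (l + 1)) {l. l + 2 \<le> m1} = free_paths (m1 - 1) q"
proof (cases "m1 = 1")
  case False
  then obtain n where n: "m1 = Suc (Suc n)" using assms by (metis One_nat_def not0_implies_Suc less_not_refl)
  have "sum (\<lambda>l. multichoose (m1 - l) q * b_num (m1 - 1) (l + 1)) {l. l + 2 \<le> m1}
     = (\<Sum>l\<in>{..n}. multichoose (Suc (Suc n) - l) q * b_num (Suc n) (Suc l))"
    unfolding n by (intro sum.cong) auto
  also have "\<dots> = (\<Sum>l\<le>n. suffix_num n (n - l) * ((n - l + 1 + q) choose q))"
  proof (intro sum.cong refl)
    fix l assume "l \<in> {..n}"
    then show "multichoose (Suc (Suc n) - l) q * b_num (Suc n) (Suc l)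
        = suffix_num n (n - l) * ((n - l + 1 + q) choose q)"
      by (simp add: b_num_eq_suffix_num multichoose_def Suc_diff_le)
  qed
  \<comment> \<open>The index is reversed, from the position of the largest entry to the number of
    entries to its right.\<close>
  also have "\<dots> = (\<Sum>s\<le>n. suffix_num n s * ((s + 1 + q) choose q))"
    by (intro sum.reindex_bij_witness[of _ "\<lambda>l. n - l" "\<lambda>l. n - l"]) auto
  also have "\<dots> = free_paths (m1 - 1) q" unfolding n diff_Suc_1 by (rule free_paths_Suc_eq[symmetric])
  moreover have "0 \<in> {l. l + 2 \<le> m1}" using n by simp
  ultimately show ?thesis by (auto simp: sum1_def)
qed (simp add: sum1_def)

theorem theorem4p16:
  fixes n m1 p1 m2 :: nat and p M1 P1 M2 :: "nat list"
  assumes "p \<in> Sym n"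
    and "ltr_max_decomp p M1 P1 M2"
    and "M2 \<noteq> []"
    and "m1 = length M1" and "p1 = length P1" and "m2 = length M2"
  shows "card (queuesort_preimage n p) =
    sum1 (\<lambda>i. sum1 (\<lambda>j.
        ((i - 1) choose j)
        * sum1 (\<lambda>l. multichoose (m1 - l) (j + 1) * b_num (m1 - 1) (l + 1)) {l. l + 2 \<le> m1}
        * sum1 (\<lambda>k. g_num (m2 - i) k * multichoose k (p1 + i - j - 1)) {2..m2 - i + 1})
      {0..i - 1}) {1..m2}"
proof -
  have "0 \<notin> set p" using assms(1) by (auto simp: permutations_of_set_def)
  note fl = flags_decomp[OF this assms(2)]
  have m1: "0 < m1" using fl(2) assms(4) by simp
  obtain K where K: "m2 = Suc K" using assms(3,6) by (metis length_0_conv not0_implies_Suc)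
  have "card (queuesort_preimage n p)
      = (\<Sum>N\<le>K. \<Sum>j\<le>N. (N choose j) * free_paths (m1 - 1) (Suc j) * free_paths (K - N) (p1 + N - j))"
    unfolding card_queuesort_preimage[OF assms(1)] fl(1)
    by (simp only: assms(4-6)[symmetric] K flag_paths_decomp)
  also have "\<dots> = (\<Sum>i\<in>{1..m2}. \<Sum>j\<in>{0..i - 1}.
      ((i - 1) choose j) * free_paths (m1 - 1) (j + 1) * free_paths (m2 - i) (p1 + i - j - 1))"
    \<comment> \<open>The outer index is shifted by \<open>i = N + 1\<close>, so that
      \<open>K - N\<close> becomes \<open>m2 - i\<close>.\<close>
    by (rule sum.reindex_bij_witness[of _ "\<lambda>i. i - 1" Suc]) (auto simp: K atLeast0AtMost)
  finally show ?thesis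
    \<comment> \<open>The two outer index sets are nonempty, so \<open>sum1\<close> is an ordinary
      sum there.\<close>
    using K m1 by (simp only: sum1_g_num sum1_b_num) (simp add: sum1_def)
qed

end
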